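(* In the setting of the context, suppose that $\mathcal P$ is perfect and that $A\in L(Y)$ is self-similar. Then the following are equivalent: (a) $A$ is invertible; (b) $A$ is Fredholm; (c) $A$ is invertible at infinity; (d) all limit operators of $A$ are invertible and their inverses are uniformly bounded; (e) all limit operators of $A$ are invertible.
   Context: $Y$ is a real or complex Banach space, $L(Y)$ the bounded linear operators on $Y$. $\mathcal P=(P_n)_{n=0}^\infty\subset L(Y)$ satisfies: (i) $\sup_n\|P_nx\|=\|x\|$ for all $x\in Y$; (ii) for every $m\in\mathbb N_0$ there is $N(m)\ge m$ with $P_nP_m=P_m=P_mP_n$ for all $n\ge N(m)$. $Q_n:=I-P_n$. $\mathcal P$ is called perfect if $P_n$ converges strongly to $I$ on $Y$ and the adjoints $P_n^*$ converge strongly to $I^*$ on $Y^*$. $K(Y,\mathcal P)$ is the set of $K\in L(Y)$ with $\|KQ_n\|\to0$ and $\|Q_nK\|\to0$ as $n\to\infty$. $A\in L(Y)$ is invertible at infinity if there are $B\in L(Y)$, $T_1,T_2\in K(Y,\mathcal P)$ with $AB=I+T_1$, $BA=I+T_2$. $\mathcal P$-convergence $A_n\stackrel{\mathcal P}{\to}A$ (for $A_n,A\in L(Y)$) means $\|(A_n-A)K\|\to0$ and $\|K(A_n-A)\|\to0$ for all $K\in K(Y,\mathcal P)$. For some $N\in\mathbb N$, $\mathcal V=\{V_k\}_{k\in\mathbb Z^N}$ is a group of linear isometries on $Y$ with $V_0=I$, $V_kV_m=V_{k+m}$, such that: for all $m,n\in\mathbb N$ there is $k_0$ with $P_mV_kP_n=0$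 if $|k|>k_0$; and for all $m\in\mathbb N$, $k\in\mathbb Z^N$ there is $n_0$ with $P_mV_kQ_n=0=Q_nV_kP_m$ if $n>n_0$. If $h=(h(n))\subset\mathbb Z^N$ with $|h(n)|\to\infty$ and $V_{-h(n)}AV_{h(n)}\stackrel{\mathcal P}{\to}A_h$, then $A_h$ is called a limit operator of $A$; $\sigma^{\sf op}(A)$ is the set of all limit operators of $A$. $A$ is self-similar if $A\in\sigma^{\sf op}(A)$. $A$ is Fredholm if $\dim\ker A<\infty$ and $\dim(Y/A(Y))<\infty$. "Invertible" means bijective. *)

theory Defs
  imports "HOL-Analysis.Analysis"
begin

text \<open>
  The scalar field is \<open>\<real>\<close> or \<open>\<complex>\<close>; in the second case \<open>i\<close> plays the role of the imaginary unit.
  The norm is then the usual absolute value, because it is multiplicative in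
  \<^class>\<open>real_normed_field\<close>.
\<close>

class real_or_complex = real_normed_field +
  assumes real_or_complex:
    "(\<forall>z. \<exists>a. z = a *\<^sub>R 1) \<or> (\<exists>i. i * i = - 1 \<and> (\<forall>z. \<exists>a b. z = a *\<^sub>R 1 + b *\<^sub>R i))"

instance real :: real_or_complex
  by standard simp

instance complex :: real_or_complex
proof
  have "\<i> * \<i> = - 1 \<and> (\<forall>z. \<exists>a b. z = a *\<^sub>R 1 + b *\<^sub>R \<i>)"
    by (auto simp: complex_eq_iff)
  then show "(\<forall>z::complex. \<exists>a. z = a *\<^sub>R 1) \<or>
      (\<exists>i::complex. i * i = - 1 \<and> (\<forall>z. \<exists>a b. z = a *\<^sub>R 1 + b *\<^sub>R i))"
    by blast
qed

text \<open>
  A Banach space over the field \<open>'k\<close>: a real Banach space \<open>'y\<close> with a compatible scalar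
  multiplication \<open>scl\<close>. The type \<^typ>\<open>'y::banach \<Rightarrow>\<^sub>L 'y\<close> consists of the bounded operators that are
  linear over the reals, so linearity over \<open>'k\<close> is imposed by membership in \<open>bounded_ops\<close>,
  and likewise for functionals in \<open>dual_space\<close>.
\<close>

locale banach_space_over = vector_space scl
  for scl :: "'k::real_or_complex \<Rightarrow> 'y::banach \<Rightarrow> 'y" +
  assumes scale_of_real: "scl (of_real r) x = r *\<^sub>R x"
    and norm_scale: "norm (scl c x) = norm c * norm x"

definition bounded_ops :: "('k::real_or_complex \<Rightarrow> 'y::banach \<Rightarrow> 'y) \<Rightarrow> ('y \<Rightarrow>\<^sub>L 'y) set" where
  "bounded_ops scl = {A :: 'y \<Rightarrow>\<^sub>L 'y. \<forall>c x. A (scl c x) = scl c (A x)}"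

definition dual_space :: "('k::real_or_complex \<Rightarrow> 'y::banach \<Rightarrow> 'y) \<Rightarrow> ('y \<Rightarrow>\<^sub>L 'k) set" where
  "dual_space scl = {f :: 'y \<Rightarrow>\<^sub>L 'k. \<forall>c x. f (scl c x) = c * f x}"

definition adjoint_op :: "('y::banach \<Rightarrow>\<^sub>L 'y) \<Rightarrow> ('y \<Rightarrow>\<^sub>L 'k::real_or_complex) \<Rightarrow> ('y \<Rightarrow>\<^sub>L 'k)" where
  "adjoint_op A f = f o\<^sub>L A"

definition compl_op :: "(nat \<Rightarrow> 'y::banach \<Rightarrow>\<^sub>L 'y) \<Rightarrow> nat \<Rightarrow> 'y \<Rightarrow>\<^sub>L 'y" where
  "compl_op P n = id_blinfun - P n"

definition perfect ::
  "('k::real_or_complex \<Rightarrow> 'y::banach \<Rightarrow> 'y) \<Rightarrow> (nat \<Rightarrow> 'y \<Rightarrow>\<^sub>L 'y) \<Rightarrow> bool" where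
  "perfect scl P \<longleftrightarrow>
     (\<forall>x. (\<lambda>n. P n x) \<longlonglongrightarrow> x) \<and>
     (\<forall>f\<in>dual_space scl. (\<lambda>n. adjoint_op (P n) f) \<longlonglongrightarrow> f)"

definition K_ops ::
  "('k::real_or_complex \<Rightarrow> 'y::banach \<Rightarrow> 'y) \<Rightarrow> (nat \<Rightarrow> 'y \<Rightarrow>\<^sub>L 'y) \<Rightarrow> ('y \<Rightarrow>\<^sub>L 'y) set" where
  "K_ops scl P = {K \<in> bounded_ops scl.
     (\<lambda>n. norm (K o\<^sub>L compl_op P n)) \<longlonglongrightarrow> 0 \<and> (\<lambda>n. norm (compl_op P n o\<^sub>L K)) \<longlonglongrightarrow> 0}"

definition invertible_at_infinity ::
  "('k::real_or_complex \<Rightarrow> 'y::banach \<Rightarrow> 'y) \<Rightarrow> (nat \<Rightarrow> 'y \<Rightarrow>\<^sub>L 'y) \<Rightarrow> ('y \<Rightarrow>\<^sub>L 'y) \<Rightarrow> bool" where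
  "invertible_at_infinity scl P A \<longleftrightarrow>
     (\<exists>B\<in>bounded_ops scl. \<exists>T\<^sub>1\<in>K_ops scl P. \<exists>T\<^sub>2\<in>K_ops scl P.
        A o\<^sub>L B = id_blinfun + T\<^sub>1 \<and> B o\<^sub>L A = id_blinfun + T\<^sub>2)"

definition P_convergent ::
  "('k::real_or_complex \<Rightarrow> 'y::banach \<Rightarrow> 'y) \<Rightarrow> (nat \<Rightarrow> 'y \<Rightarrow>\<^sub>L 'y) \<Rightarrow>
    (nat \<Rightarrow> 'y \<Rightarrow>\<^sub>L 'y) \<Rightarrow> ('y \<Rightarrow>\<^sub>L 'y) \<Rightarrow> bool" where
  "P_convergent scl P A B \<longleftrightarrow>
     (\<forall>K\<in>K_ops scl P.
        (\<lambda>n. norm ((A n - B) o\<^sub>L K)) \<longlonglongrightarrow> 0 \<and> (\<lambda>n. norm (K o\<^sub>L (A n - B))) \<longlonglongrightarrow> 0)"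

text \<open>
  The set \<open>\<int>\<^sup>N\<close> is \<^typ>\<open>int ^ 'n\<close>, and the modulus on it is the maximum norm (all norms give the
  same notions below).
\<close>

definition znorm :: "int ^ 'n \<Rightarrow> int" where
  "znorm k = Max (range (\<lambda>i. \<bar>k $ i\<bar>))"

definition is_limit_operator ::
  "('k::real_or_complex \<Rightarrow> 'y::banach \<Rightarrow> 'y) \<Rightarrow> (nat \<Rightarrow> 'y \<Rightarrow>\<^sub>L 'y) \<Rightarrow> (int ^ 'n \<Rightarrow> 'y \<Rightarrow>\<^sub>L 'y) \<Rightarrow>
    ('y \<Rightarrow>\<^sub>L 'y) \<Rightarrow> (nat \<Rightarrow> int ^ 'n) \<Rightarrow> ('y \<Rightarrow>\<^sub>L 'y) \<Rightarrow> bool" where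
  "is_limit_operator scl P V A h A\<^sub>h \<longleftrightarrow>
     A\<^sub>h \<in> bounded_ops scl \<and>
     filterlim (\<lambda>n. znorm (h n)) at_top sequentially \<and>
     P_convergent scl P (\<lambda>n. V (- h n) o\<^sub>L A o\<^sub>L V (h n)) A\<^sub>h"

definition op_spectrum ::
  "('k::real_or_complex \<Rightarrow> 'y::banach \<Rightarrow> 'y) \<Rightarrow> (nat \<Rightarrow> 'y \<Rightarrow>\<^sub>L 'y) \<Rightarrow> (int ^ 'n \<Rightarrow> 'y \<Rightarrow>\<^sub>L 'y) \<Rightarrow>
    ('y \<Rightarrow>\<^sub>L 'y) \<Rightarrow> ('y \<Rightarrow>\<^sub>L 'y) set" where
  "op_spectrum scl P V A = {A\<^sub>h. \<exists>h. is_limit_operator scl P V A h A\<^sub>h}"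

definition self_similar ::
  "('k::real_or_complex \<Rightarrow> 'y::banach \<Rightarrow> 'y) \<Rightarrow> (nat \<Rightarrow> 'y \<Rightarrow>\<^sub>L 'y) \<Rightarrow> (int ^ 'n \<Rightarrow> 'y \<Rightarrow>\<^sub>L 'y) \<Rightarrow>
    ('y \<Rightarrow>\<^sub>L 'y) \<Rightarrow> bool" where
  "self_similar scl P V A \<longleftrightarrow> A \<in> op_spectrum scl P V A"

definition coset_of :: "'y::ab_group_add set \<Rightarrow> 'y \<Rightarrow> 'y set" where
  "coset_of M y = (+) y ` M"

definition finite_dim :: "('k::field \<Rightarrow> 'y::ab_group_add \<Rightarrow> 'y) \<Rightarrow> 'y set \<Rightarrow> bool" where
  "finite_dim scl S \<longleftrightarrow> (\<exists>F. finite F \<and> module.span scl F = S)"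

text \<open>
  The quotient by the subspace \<open>M\<close> is the set \<^term>\<open>range (coset_of M)\<close> of all cosets. It is
  finite-dimensional if it is spanned by the cosets of finitely many vectors, and their span in the
  quotient is the image of the span of these vectors.
\<close>

definition finite_dim_quotient :: "('k::field \<Rightarrow> 'y::ab_group_add \<Rightarrow> 'y) \<Rightarrow> 'y set \<Rightarrow> bool" where
  "finite_dim_quotient scl M \<longleftrightarrow>
     (\<exists>F. finite F \<and> coset_of M ` module.span scl F = range (coset_of M))"

definition fredholm :: "('k::real_or_complex \<Rightarrow> 'y::banach \<Rightarrow> 'y) \<Rightarrow> ('y \<Rightarrow>\<^sub>L 'y) \<Rightarrow> bool" where
  "fredholm scl A \<longleftrightarrow>
     finite_dim scl {x. blinfun_apply A x = 0} \<and> finite_dim_quotient scl (range (blinfun_apply A))"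

definition invertible_op :: "('y::banach \<Rightarrow>\<^sub>L 'y) \<Rightarrow> bool" where
  "invertible_op A \<longleftrightarrow> bij (blinfun_apply A)"

definition inverses_uniformly_bounded :: "('y::banach \<Rightarrow>\<^sub>L 'y) set \<Rightarrow> bool" where
  "inverses_uniformly_bounded S \<longleftrightarrow>
     (\<exists>C. \<forall>B\<in>S. \<forall>x. norm (inv (blinfun_apply B) x) \<le> C * norm x)"

text \<open>
  In the conditions on \<open>V\<close>, the indices \<open>m\<close> and \<open>n\<close> of \<open>P\<close> range over the positive integers,
  whereas the sequence \<open>P\<close> itself starts at \<open>0\<close>.
\<close>

locale limit_operator_setting = banach_space_over scl
  for scl :: "'k::real_or_complex \<Rightarrow> 'y::banach \<Rightarrow> 'y" +
  fixes P :: "nat \<Rightarrow> 'y \<Rightarrow>\<^sub>L 'y"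
    and V :: "int ^ 'n \<Rightarrow> 'y \<Rightarrow>\<^sub>L 'y"
  assumes P_op: "P n \<in> bounded_ops scl"
    and P_bdd: "bdd_above (range (\<lambda>n. norm (P n x)))"
    and P_sup: "(SUP n. norm (P n x)) = norm x"
    and P_absorb: "\<exists>N\<ge>m. \<forall>n\<ge>N. P n o\<^sub>L P m = P m \<and> P m o\<^sub>L P n = P m"
    and V_op: "V k \<in> bounded_ops scl"
    and V_isometry: "norm (V k x) = norm x"
    and V_zero: "V 0 = id_blinfun"
    and V_add: "V k o\<^sub>L V l = V (k + l)"
    and P_V_P: "m \<ge> 1 \<Longrightarrow> n \<ge> 1 \<Longrightarrow> \<exists>k\<^sub>0. \<forall>k. znorm k > k\<^sub>0 \<longrightarrow> P m o\<^sub>L V k o\<^sub>L P n = 0"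
    and P_V_Q: "m \<ge> 1 \<Longrightarrow> \<exists>n\<^sub>0. \<forall>n>n\<^sub>0.
      P m o\<^sub>L V k o\<^sub>L compl_op P n = 0 \<and> compl_op P n o\<^sub>L V k o\<^sub>L P m = 0"

end

theory Submission
  imports Defs
begin

text \<open>
  Write \<open>Q\<^sub>n = I - P\<^sub>n\<close>. The proof compares \<open>A\<close> with its limit operators through a weak form of
  invertibility. Call a set tight if \<open>Q\<^sub>n\<close> can be made uniformly small on it; since \<open>P\<^sub>n \<rightarrow> I\<close>
  strongly, compact sets are tight, and the images of the unit ball under operators in \<open>K(Y, P)\<close>
  are tight by definition. Call \<open>A\<close> invertible modulo tight sets with constant \<open>C\<close>
  (\<open>invertible_modulo_tight\<close>) if on the unit ball every \<open>x\<close> agrees with an element of one tight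
  set up to an error of norm at most \<open>C * norm (A x)\<close>, and every \<open>y\<close> agrees with some \<open>A x\<close>,
  \<open>norm x \<le> C\<close>, up to an element of another tight set.

  Tight sets are lost under shifts to infinity: if \<open>s\<^sub>n\<close> runs through a bounded tight set and
  \<open>|h n| \<rightarrow> \<infinity>\<close>, then \<open>P\<^sub>m V(h n) s\<^sub>n \<rightarrow> 0\<close> for each \<open>m\<close>. Therefore the tight errors disappear in
  the limit and every limit operator \<open>B\<close> of \<open>A\<close> is invertible (\<open>limit_operator_invertible\<close>). On
  the one hand \<open>norm x \<le> 2 * C * norm (B x)\<close>, so that \<open>B\<close> is injective with closed range. On the other hand a bounded functional \<open>f\<close> with \<open>f \<circ> B = 0\<close> has to vanish, because
  \<open>f \<circ> V(- h n) \<circ> A \<circ> V(h n) \<rightarrow> 0\<close> in norm; here the strong convergence of the adjoints \<open>P\<^sub>n\<^sup>*\<close> enters.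
  By the Hahn-Banach theorem the range of \<open>B\<close> is then everything. The bound on \<open>B\<^sup>-\<^sup>1\<close> depends only
  on \<open>A\<close>.

  An operator that is invertible at infinity is invertible modulo tight sets directly from the
  definitions (\<open>invertible_at_infinity_modulo_tight\<close>). For a Fredholm operator the tight sets are
  bounded subsets of finite-dimensional spaces, and \<open>C\<close> comes from the open mapping theorem
  (\<open>fredholm_modulo_tight\<close>). Hence each of (b) and (c) implies (d). Trivially (d) implies (e), and
  (e) implies (a) because a self-similar operator is one of its own limit operators. Finally (a)
  implies (b) and (c); the latter uses that the inverse is bounded.
\<close>


section \<open>Separation of a point from a closed subspace by a bounded functional\<close>

definition sublinear :: "('a::real_vector \<Rightarrow> real) \<Rightarrow> bool" where
  "sublinear q \<longleftrightarrow>
     (\<forall>x y. q (x + y) \<le> q x + q y) \<and> (\<forall>t\<ge>0. \<forall>x. q (t *\<^sub>R x) = t * q x)"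

lemma sublinear_add: "sublinear q \<Longrightarrow> q (x + y) \<le> q x + q y"
  and sublinear_scale: "sublinear q \<Longrightarrow> 0 \<le> t \<Longrightarrow> q (t *\<^sub>R x) = t * q x"
  by (auto simp: sublinear_def)

lemma sublinear_zero: "sublinear q \<Longrightarrow> q 0 = 0"
  using sublinear_scale[of q 0 0] by simp

lemma sublinear_neg: "sublinear q \<Longrightarrow> - q (- x) \<le> q x"
  using sublinear_add[of q x "- x"] by (simp add: sublinear_zero)

lemma sublinearI:
  assumes add: "\<And>x y. q (x + y) \<le> q x + q y"
    and zero: "q 0 = 0"
    and scale: "\<And>t x. 0 < t \<Longrightarrow> q (t *\<^sub>R x) \<le> t * q x"
  shows "sublinear q"
proof -
  have "q (t *\<^sub>R x) = t * q x" if "0 < t" for t x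
  proof (rule antisym)
    show "q (t *\<^sub>R x) \<le> t * q x"
      by (rule scale[OF that])
    have "q ((1 / t) *\<^sub>R t *\<^sub>R x) \<le> 1 / t * q (t *\<^sub>R x)"
      by (rule scale) (use that in simp)
    then show "t * q x \<le> q (t *\<^sub>R x)"
      using that by (simp add: field_simps)
  qed
  then show ?thesis
    using add zero unfolding sublinear_def
    by (metis less_eq_real_def mult_zero_left scaleR_zero_left)
qed

text \<open>
  The infimum makes \<open>q\<close> smaller while keeping it sublinear, and forces additivity along the line
  through \<open>v\<close>: the new functional takes at \<open>- v\<close> at most the value \<open>- q v\<close>. A sublinear functional
  that cannot be made smaller in this way is linear.
\<close>
definition straighten :: "('a::real_vector \<Rightarrow> real) \<Rightarrow> 'a \<Rightarrow> 'a \<Rightarrow> real" where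
  "straighten q v x = (INF t\<in>{0..}. q (x + t *\<^sub>R v) - t * q v)"

lemma straighten_bdd_below:
  assumes "sublinear q"
  shows "bdd_below ((\<lambda>t. q (x + t *\<^sub>R v) - t * q v) ` {0..})"
proof (rule bdd_belowI2)
  fix t :: real
  assume "t \<in> {0..}"
  then have "t * q v = q ((x + t *\<^sub>R v) + (- x))"
    using sublinear_scale[OF assms, of t v] by simp
  also have "\<dots> \<le> q (x + t *\<^sub>R v) + q (- x)"
    by (rule sublinear_add[OF assms])
  finally show "- q (- x) \<le> q (x + t *\<^sub>R v) - t * q v"
    by simp
qed

lemma straighten_le:
  assumes "sublinear q" "0 \<le> t"
  shows "straighten q v x \<le> q (x + t *\<^sub>R v) - t * q v"
  unfolding straighten_def
  by (rule cINF_lower[OF straighten_bdd_below]) (use assms in auto)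

lemma straighten_greatest:
  assumes "\<And>t. 0 \<le> t \<Longrightarrow> c \<le> q (x + t *\<^sub>R v) - t * q v"
  shows "c \<le> straighten q v x"
  unfolding straighten_def by (rule cINF_greatest) (use assms in auto)

lemma sublinear_straighten:
  assumes q: "sublinear q"
  shows "sublinear (straighten q v)"
proof (rule sublinearI)
  fix x y
  have "straighten q v (x + y) - (q (y + t *\<^sub>R v) - t * q v) \<le> straighten q v x"
    if t: "0 \<le> t" for t
  proof (rule straighten_greatest)
    fix s :: real
    assume s: "0 \<le> s"
    have "straighten q v (x + y) \<le> q ((x + s *\<^sub>R v) + (y + t *\<^sub>R v)) - (s + t) * q v"
      using straighten_le[OF q, of "s + t" v "x + y"] s t by (simp add: algebra_simps)
    also have "\<dots> \<le> q (x + s *\<^sub>R v) + q (y + t *\<^sub>R v) - (s + t) * q v"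
      using sublinear_add[OF q, of "x + s *\<^sub>R v" "y + t *\<^sub>R v"] by simp
    finally show "straighten q v (x + y) - (q (y + t *\<^sub>R v) - t * q v)
        \<le> q (x + s *\<^sub>R v) - s * q v"
      by (simp add: algebra_simps)
  qed
  then have "straighten q v (x + y) - straighten q v x \<le> straighten q v y"
    by (intro straighten_greatest) (simp add: algebra_simps)
  then show "straighten q v (x + y) \<le> straighten q v x + straighten q v y"
    by simp
next
  show "straighten q v 0 = 0"
  proof (rule antisym)
    show "straighten q v 0 \<le> 0"
      using straighten_le[OF q, of 0 v 0] by (simp add: sublinear_zero[OF q])
    show "0 \<le> straighten q v 0"
      by (rule straighten_greatest) (simp add: sublinear_scale[OF q])
  qed
next
  fix c :: real and x
  assume c: "0 < c"
  have "straighten q v (c *\<^sub>R x) / c \<le> straighten q v x"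
  proof (rule straighten_greatest)
    fix t :: real
    assume t: "0 \<le> t"
    have "straighten q v (c *\<^sub>R x) \<le> q (c *\<^sub>R (x + t *\<^sub>R v)) - (c * t) * q v"
      using straighten_le[OF q, of "c * t" v "c *\<^sub>R x"] c t by (simp add: algebra_simps)
    also have "\<dots> = c * (q (x + t *\<^sub>R v) - t * q v)"
      using c sublinear_scale[OF q, of c "x + t *\<^sub>R v"] by (simp add: algebra_simps)
    finally show "straighten q v (c *\<^sub>R x) / c \<le> q (x + t *\<^sub>R v) - t * q v"
      using c by (simp add: field_simps)
  qed
  then show "straighten q v (c *\<^sub>R x) \<le> c * straighten q v x"
    using c by (simp add: field_simps)
qed

lemma straighten_le_self: "sublinear q \<Longrightarrow> straighten q v x \<le> q x"
  using straighten_le[of q 0 v x] by simp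

lemma straighten_neg: "sublinear q \<Longrightarrow> straighten q v (- v) \<le> - q v"
  using straighten_le[of q 1 v "- v"] by (simp add: sublinear_zero)

text \<open>
  Zorn's lemma applies because each sublinear \<open>q \<le> p\<close> satisfies \<open>q x \<ge> - p (- x)\<close>, so that the
  pointwise infimum of a chain is finite. The infimum is subadditive because the smaller one of two
  members of the chain serves for both summands.
\<close>
lemma minimal_sublinear:
  assumes p: "sublinear p"
  obtains q where "sublinear q" "q \<le> p" "\<And>q'. sublinear q' \<Longrightarrow> q' \<le> q \<Longrightarrow> q' = q"
proof -
  define S where "S = {q. sublinear q \<and> q \<le> p}"
  have "\<exists>m\<in>S. \<forall>q\<in>S. m \<ge> q \<longrightarrow> q = m"
  proof (rule predicate_Zorn)
    show "partial_order_on S (relation_of (\<ge>) S)"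
      by (rule partial_order_on_relation_ofI) auto
  next
    fix C
    assume C: "C \<in> Chains (relation_of (\<ge>) S)"
    have CS: "q \<in> S" if "q \<in> C" for q
      using C that by (auto simp: Chains_def relation_of_def)
    have total: "q \<le> r \<or> r \<le> q" if "q \<in> C" "r \<in> C" for q r
      using C that by (auto simp: Chains_def relation_of_def)
    show "\<exists>u\<in>S. \<forall>q\<in>C. q \<ge> u"
    proof (cases "C = {}")
      case True
      then show ?thesis
        using p by (auto simp: S_def)
    next
      case False
      define u where "u x = (INF q\<in>C. q x)" for x
      have bdd: "bdd_below ((\<lambda>q. q x) ` C)" for x
      proof (rule bdd_belowI2)
        fix q
        assume "q \<in> C"
        then have "sublinear q" "q (- x) \<le> p (- x)"
          using CS by (auto simp: S_def le_fun_def)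
        then show "- p (- x) \<le> q x"
          using sublinear_neg[of q x] by linarith
      qed
      have lower: "u x \<le> q x" if "q \<in> C" for q x
        unfolding u_def by (rule cINF_lower[OF bdd that])
      have greatest: "c \<le> u x" if "\<And>q. q \<in> C \<Longrightarrow> c \<le> q x" for c x
        unfolding u_def by (rule cINF_greatest[OF False that])
      have "sublinear u"
      proof (rule sublinearI)
        fix x y
        have "u (x + y) - r y \<le> u x" if r: "r \<in> C" for r
        proof (rule greatest)
          fix q
          assume q: "q \<in> C"
          define s where "s = (if q \<le> r then q else r)"
          have s: "s \<in> C" "s \<le> q" "s \<le> r"
            using q r total by (auto simp: s_def)
          have "u (x + y) \<le> s (x + y)"
            by (rule lower[OF s(1)])
          also have "\<dots> \<le> s x + s y"
            using CS[OF s(1)] by (auto simp: S_def intro: sublinear_add)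
          also have "\<dots> \<le> q x + r y"
            using s by (auto simp: le_fun_def intro: add_mono)
          finally show "u (x + y) - r y \<le> q x"
            by simp
        qed
        then have "u (x + y) - u x \<le> u y"
          by (intro greatest) (simp add: algebra_simps)
        then show "u (x + y) \<le> u x + u y"
          by simp
      next
        have "q 0 = 0" if "q \<in> C" for q
          using CS[OF that] by (auto simp: S_def intro: sublinear_zero)
        then show "u 0 = 0"
          using False lower greatest[of 0 0] by (metis antisym equals0I order_refl)
      next
        fix t :: real and x
        assume t: "0 < t"
        have "u (t *\<^sub>R x) / t \<le> u x"
        proof (rule greatest)
          fix q
          assume q: "q \<in> C"
          have "u (t *\<^sub>R x) \<le> q (t *\<^sub>R x)"
            by (rule lower[OF q])
          also have "\<dots> = t * q x"
            using CS[OF q] t by (auto simp: S_def sublinear_scale)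
          finally show "u (t *\<^sub>R x) / t \<le> q x"
            using t by (simp add: field_simps)
        qed
        then show "u (t *\<^sub>R x) \<le> t * u x"
          using t by (simp add: field_simps)
      qed
      moreover have "u \<le> p"
        using False lower CS by (fastforce simp: S_def le_fun_def intro: order_trans)
      ultimately show ?thesis
        using lower by (auto simp: S_def le_fun_def)
    qed
  qed
  then show ?thesis
    using that by (auto simp: S_def intro: order_trans)
qed

text \<open>
  Hahn-Banach. Minimality gives linearity; starting the minimisation from \<open>straighten p v\<close> instead
  of \<open>p\<close> pins the value at the prescribed vector \<open>v\<close>.
\<close>
theorem sublinear_dominates_linear:
  assumes p: "sublinear (p :: 'a::real_vector \<Rightarrow> real)"
  obtains r where "linear r" "\<And>x. r x \<le> p x" "r v = p v"
proof -
  obtain q where q: "sublinear q" "q \<le> straighten p v"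
    and min: "\<And>q'. sublinear q' \<Longrightarrow> q' \<le> q \<Longrightarrow> q' = q"
    using minimal_sublinear[OF sublinear_straighten[OF p]] by metis
  have neg: "q (- x) = - q x" for x
  proof -
    have "straighten q x = q"
      by (rule min[OF sublinear_straighten[OF q(1)]])
        (simp add: le_fun_def straighten_le_self[OF q(1)])
    then have "q (- x) \<le> - q x"
      using straighten_neg[OF q(1), of x] by simp
    then show ?thesis
      using sublinear_neg[OF q(1), of x] by simp
  qed
  have "linear q"
  proof (rule linearI)
    fix x y
    have "q (- (x + y)) \<le> q (- x) + q (- y)"
      using sublinear_add[OF q(1), of "- x" "- y"] by simp
    then show "q (x + y) = q x + q y"
      using sublinear_add[OF q(1), of x y] neg[of "x + y"] by (simp add: neg)
  next
    fix t x
    show "q (t *\<^sub>R x) = t *\<^sub>R q x"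
    proof (cases "0 \<le> t")
      case True
      then show ?thesis
        by (simp add: sublinear_scale[OF q(1)])
    next
      case False
      then have "q ((- t) *\<^sub>R x) = (- t) * q x"
        by (intro sublinear_scale[OF q(1)]) simp
      then show ?thesis
        by (simp add: neg)
    qed
  qed
  moreover have le: "q x \<le> p x" for x
    using q(2) straighten_le_self[OF p] by (auto simp: le_fun_def intro: order_trans)
  moreover have "q v = p v"
  proof (rule antisym[OF le])
    have "q (- v) \<le> straighten p v (- v)"
      using q(2) by (simp add: le_fun_def)
    then show "p v \<le> q v"
      using straighten_neg[OF p, of v] by (simp add: neg)
  qed
  ultimately show ?thesis
    by (rule that)
qed

lemma sublinear_infdist:
  fixes M :: "'a::real_normed_vector set"
  assumes M: "subspace M"
  shows "sublinear (\<lambda>x. infdist x M)"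
proof (rule sublinearI)
  have ne: "M \<noteq> {}"
    using subspace_0[OF M] by auto
  have greatest: "c \<le> infdist x M" if "\<And>m. m \<in> M \<Longrightarrow> c \<le> dist x m" for c x
    using that ne by (auto simp: infdist_notempty intro: cINF_greatest)
  fix x y
  have "infdist (x + y) M - dist y n \<le> infdist x M" if n: "n \<in> M" for n
  proof (rule greatest)
    fix m
    assume m: "m \<in> M"
    have "infdist (x + y) M \<le> dist (x + y) (m + n)"
      by (rule infdist_le[OF subspace_add[OF M m n]])
    also have "\<dots> \<le> dist x m + dist y n"
      by (rule dist_triangle_add)
    finally show "infdist (x + y) M - dist y n \<le> dist x m"
      by simp
  qed
  then have "infdist (x + y) M - infdist x M \<le> infdist y M"
    by (intro greatest) (simp add: algebra_simps)
  then show "infdist (x + y) M \<le> infdist x M + infdist y M"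
    by simp
  show "infdist 0 M = 0"
    using subspace_0[OF M] by simp
  fix t :: real
  assume t: "0 < t"
  have "infdist (t *\<^sub>R x) M / t \<le> infdist x M"
  proof (rule greatest)
    fix m
    assume m: "m \<in> M"
    have "infdist (t *\<^sub>R x) M \<le> dist (t *\<^sub>R x) (t *\<^sub>R m)"
      by (rule infdist_le[OF subspace_scale[OF M m]])
    also have "\<dots> = t * dist x m"
      using t by (simp add: dist_norm flip: scaleR_diff_right)
    finally show "infdist (t *\<^sub>R x) M / t \<le> dist x m"
      using t by (simp add: field_simps)
  qed
  then show "infdist (t *\<^sub>R x) M \<le> t * infdist x M"
    using t by (simp add: field_simps)
qed

text \<open>
  The distance to \<open>M\<close> is sublinear, vanishes on \<open>M\<close>, is positive at \<open>y\<close> and is at most the norm. A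
  linear functional below it also vanishes on \<open>M\<close> and is bounded, and it can be chosen to agree
  with the distance at \<open>y\<close>.
\<close>
lemma closed_subspace_separation:
  fixes M :: "'a::real_normed_vector set"
  assumes M: "subspace M" "closed M" and y: "y \<notin> M"
  obtains r :: "'a \<Rightarrow> real" where "bounded_linear r" "\<And>x. x \<in> M \<Longrightarrow> r x = 0" "r y \<noteq> 0"
proof -
  obtain r where r: "linear r" "\<And>x. r x \<le> infdist x M" "r y = infdist y M"
    using sublinear_dominates_linear[OF sublinear_infdist[OF M(1)]] by blast
  have "\<bar>r x\<bar> \<le> infdist x M" for x
  proof -
    have "infdist (- x) M \<le> infdist x M"
    proof -
      have "infdist (- x) M \<le> dist x m" if "m \<in> M" for m
        using infdist_le[OF subspace_neg[OF M(1) that], of "- x"]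
        by (simp add: dist_norm norm_minus_commute)
      then show ?thesis
        using subspace_0[OF M(1)] by (subst (2) infdist_notempty) (auto intro!: cINF_greatest)
    qed
    then show ?thesis
      using r(2)[of x] r(2)[of "- x"] linear_neg[OF r(1), of x] by simp
  qed
  note abs_le = this
  have "bounded_linear r"
  proof (rule bounded_linear_intro[where K = 1])
    fix x
    have "infdist x M \<le> norm x"
      using infdist_le[OF subspace_0[OF M(1)], of x] by simp
    then show "norm (r x) \<le> norm x * 1"
      using abs_le[of x] by simp
  qed (simp_all add: r(1) linear_add linear_scale)
  moreover have "r x = 0" if "x \<in> M" for x
    using abs_le[of x] that by simp
  moreover have "r y \<noteq> 0"
    using r(3) infdist_pos_not_in_closed[OF M(2) _ y] subspace_0[OF M(1)] by force
  ultimately show ?thesis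
    by (rule that)
qed

context banach_space_over
begin

lemma scale_scaleR: "scl c (r *\<^sub>R x) = r *\<^sub>R scl c x"
  by (simp add: scale_left_commute flip: scale_of_real)

lemma bounded_linear_scale: "bounded_linear (scl c)"
  by (rule bounded_linear_intro[where K = "norm c"])
    (simp_all add: scale_right_distrib scale_scaleR norm_scale mult.commute)

lemma real_subspace: "subspace M \<Longrightarrow> Real_Vector_Spaces.subspace M"
  by (auto simp: Real_Vector_Spaces.subspace_def subspace_def simp flip: scale_of_real)

text \<open>
  Over the complex numbers a real-linear functional \<open>r\<close> is turned into the complex-linear functional
  \<open>x \<mapsto> r x - i r (i x)\<close>, which still vanishes on a complex subspace on which \<open>r\<close> vanishes.
\<close>
lemma dual_space_separation:
  assumes M: "subspace M" "closed M" and y: "y \<notin> M"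
  obtains f where "f \<in> dual_space scl" "\<And>x. x \<in> M \<Longrightarrow> f x = 0" "f y \<noteq> 0"
proof -
  obtain r :: "'y \<Rightarrow> real" where r: "bounded_linear r" "\<And>x. x \<in> M \<Longrightarrow> r x = 0" "r y \<noteq> 0"
    using closed_subspace_separation[OF real_subspace[OF M(1)] M(2) y] by blast
  interpret r: bounded_linear r
    by (rule r(1))
  have of_real_r: "bounded_linear (\<lambda>x. of_real (r x) :: 'k)"
    by (rule bounded_linear_compose[OF bounded_linear_of_real r(1)])
  have "\<exists>f. bounded_linear f \<and> (\<forall>c x. f (scl c x) = c * f x) \<and> (\<forall>x\<in>M. f x = 0) \<and> f y \<noteq> 0"
    using real_or_complex
  proof (elim disjE exE conjE)
    assume real: "\<forall>z::'k. \<exists>a. z = a *\<^sub>R 1"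
    have "of_real (r (scl c x)) = c * of_real (r x)" for c x
    proof -
      obtain a where "c = of_real a"
        using real by (metis of_real_def)
      then show ?thesis
        by (simp add: scale_of_real r.scaleR)
    qed
    then show ?thesis
      using of_real_r r(2,3) by (intro exI[of _ "\<lambda>x. of_real (r x)"]) auto
  next
    fix i :: 'k
    assume i: "i * i = - 1" and complex: "\<forall>z. \<exists>a b. z = a *\<^sub>R 1 + b *\<^sub>R i"
    define f where "f x = of_real (r x) - i * of_real (r (scl i x))" for x
    have "bounded_linear f"
      unfolding f_def
      by (intro bounded_linear_sub of_real_r bounded_linear_const_mult
          bounded_linear_compose[OF of_real_r bounded_linear_scale])
    moreover have "f (scl c x) = c * f x" for c x
    proof -
      obtain a b where c: "c = of_real a + of_real b * i"
        using complex by (metis of_real_def scaleR_conv_of_real)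
      have ii: "scl i (scl i x) = - x"
        by (simp add: i)
      have cx: "scl c x = a *\<^sub>R x + b *\<^sub>R scl i x"
        by (simp add: c scale_left_distrib scale_of_real flip: scale_scale)
      then have icx: "scl i (scl c x) = a *\<^sub>R scl i x - b *\<^sub>R x"
        by (simp add: scale_right_distrib scale_scaleR ii del: scale_scale)
      have "f (scl c x) = of_real a * of_real (r x) + of_real b * of_real (r (scl i x))
          - i * (of_real a * of_real (r (scl i x)) - of_real b * of_real (r x))"
        unfolding f_def cx icx[unfolded cx] by (simp add: r.add r.diff r.scaleR)
      also have "\<dots> = of_real a * of_real (r x) - (i * i) * of_real b * of_real (r (scl i x))
          - i * (of_real a * of_real (r (scl i x)) - of_real b * of_real (r x))"
        by (simp add: i)
      also have "\<dots> = c * f x"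
        by (simp add: c f_def algebra_simps)
      finally show ?thesis .
    qed
    moreover have "f x = 0" if "x \<in> M" for x
      using r(2) that subspace_scale[OF M(1) that, of i] by (simp add: f_def)
    moreover have "f y \<noteq> 0"
    proof
      \<comment> \<open>If \<open>a = i b\<close> with \<open>a\<close> and \<open>b\<close> real, then \<open>a\<^sup>2 = - b\<^sup>2\<close>, so \<open>a = 0\<close>.\<close>
      assume "f y = 0"
      then have eq: "of_real (r y) = i * of_real (r (scl i y))"
        by (simp add: f_def)
      have "of_real (r y * r y) = (i * i) * of_real (r (scl i y) * r (scl i y))"
        by (simp add: eq algebra_simps)
      then have "of_real (r y * r y) = (of_real (- (r (scl i y) * r (scl i y))) :: 'k)"
        by (simp add: i)
      then have "r y * r y = - (r (scl i y) * r (scl i y))"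
        by (simp only: of_real_eq_iff)
      then have "r y = 0"
        by (smt (verit) mult_eq_0_iff zero_le_square)
      then show False
        using r(3) by simp
    qed
    ultimately show ?thesis
      by blast
  qed
  then obtain f where f: "bounded_linear f" "\<And>c x. f (scl c x) = c * f x"
      "\<And>x. x \<in> M \<Longrightarrow> f x = 0" "f y \<noteq> 0"
    by blast
  show ?thesis
    by (rule that[of "Blinfun f"]) (auto simp: dual_space_def bounded_linear_Blinfun_apply f)
qed

text \<open>
  Adjoining \<open>i F\<close> to \<open>F\<close> reduces finite-dimensional subspaces over the scalar field to real ones. There
  coefficients can be bounded one at a time, which gives the compactness of balls.
\<close>
lemma span_subset_real_span:
  assumes "finite F"
  obtains G where "finite G" "span F \<subseteq> Real_Vector_Spaces.span G"
proof -
  obtain i :: 'k where i: "\<And>z. \<exists>a b. z = of_real a + of_real b * i"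
    using real_or_complex
    by (metis add_0_right mult_zero_left of_real_0 of_real_def scaleR_conv_of_real)
  let ?G = "F \<union> scl i ` F"
  have "x \<in> Real_Vector_Spaces.span ?G" if "x \<in> span F" for x
    using that
  proof (induction rule: span_induct_alt)
    case base
    show ?case
      by (rule real_vector.span_zero)
  next
    case (step c v y)
    obtain a b where "c = of_real a + of_real b * i"
      using i by blast
    then have "scl c v = a *\<^sub>R v + b *\<^sub>R scl i v"
      by (simp add: scale_left_distrib scale_of_real flip: scale_scale)
    then show ?case
      using step by (auto intro!: real_vector.span_add real_vector.span_scale
          intro: real_vector.span_base)
  qed
  then show ?thesis
    using that[of ?G] assms by auto
qed

end

section \<open>Surjections of Banach spaces and finite-dimensional subspaces\<close>

text \<open>
  The open mapping theorem. Restricting \<open>T\<close> to a closed subspace \<open>D\<close> allows sums of an operator and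
  an inclusion of a finite-dimensional space to be treated with \<open>D\<close> inside a product type. By
  Baire's theorem the closure of the image of some ball has interior points; differences of such
  images then approximate every \<open>y\<close> up to half its norm, and iterating on the remainders gives a
  convergent series of preimages.
\<close>
lemma bounded_preimage_of_surjective:
  fixes T :: "'a::banach \<Rightarrow> 'b::banach"
  assumes T: "bounded_linear T" and D: "subspace D" "closed D" and surj: "T ` D = UNIV"
  obtains C where "0 \<le> C" "\<And>y. \<exists>x\<in>D. T x = y \<and> norm x \<le> C * norm y"
proof -
  interpret T: bounded_linear T
    by (rule T)
  let ?B = "\<lambda>n::nat. closure (T ` (D \<inter> cball 0 (real n)))"
  have "\<exists>n. interior (?B n) \<noteq> {}"
  proof (rule ccontr)
    assume "\<nexists>n. interior (?B n) \<noteq> {}"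
    then have "euclidean interior_of \<Union>(range ?B) = {}"
      by (intro Baire_category_alt)
        (auto simp: completely_metrizable_space_euclidean)
    moreover have "\<Union>(range ?B) = UNIV"
    proof -
      have "y \<in> \<Union>(range ?B)" for y
      proof -
        obtain x where x: "x \<in> D" "T x = y"
          using surj by (metis UNIV_I imageE)
        obtain n :: nat where "norm x \<le> n"
          using real_arch_simple by blast
        then have "y \<in> ?B n"
          using x by (intro subsetD[OF closure_subset] image_eqI[of y T x]) auto
        then show ?thesis
          by blast
      qed
      then show ?thesis
        by blast
    qed
    ultimately show False
      by (metis UNIV_not_empty euclidean_interior_of interior_UNIV)
  qed
  then obtain n y\<^sub>0 where "y\<^sub>0 \<in> interior (?B n)"
    by blast
  then obtain r where r: "0 < r" "cball y\<^sub>0 r \<subseteq> ?B n"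
    unfolding mem_interior_cball by blast
  define C where "C = 2 * real n / r"
  have C: "0 \<le> C"
    using r by (simp add: C_def)
  have approx: "\<exists>x\<in>D. norm x \<le> C * norm y \<and> norm (y - T x) \<le> norm y / 2" for y
  proof (cases "y = 0")
    case True
    then show ?thesis
      using subspace_0[OF D(1)] by (intro bexI[of _ 0]) (auto simp: T.zero)
  next
    case False
    define c where "c = r / norm y"
    have c: "0 < c"
      using False r by (simp add: c_def)
    define e where "e = r / 4"
    have e: "0 < e"
      using r by (simp add: e_def)
    have "y\<^sub>0 + c *\<^sub>R y \<in> ?B n" "y\<^sub>0 \<in> ?B n"
      using r False by (auto simp: subset_iff dist_norm c_def)
    then obtain u w where u: "u \<in> D" "norm u \<le> n" "dist (T u) (y\<^sub>0 + c *\<^sub>R y) < e"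
      and w: "w \<in> D" "norm w \<le> n" "dist (T w) y\<^sub>0 < e"
      unfolding closure_approachable using e by fastforce
    define x where "x = (1 / c) *\<^sub>R (u - w)"
    have "x \<in> D"
      using u w D(1) by (simp add: x_def subspace_diff subspace_scale)
    moreover have "norm x \<le> C * norm y"
    proof -
      have "norm (u - w) \<le> 2 * n"
        using u(2) w(2) norm_triangle_ineq4[of u w] by simp
      then have "norm x \<le> (1 / c) * (2 * n)"
        unfolding x_def norm_scaleR using c by (intro mult_mono) auto
      also have "\<dots> = C * norm y"
        using r by (simp add: C_def c_def)
      finally show ?thesis .
    qed
    moreover have "norm (y - T x) \<le> norm y / 2"
    proof -
      have "c *\<^sub>R (y - T x) = (T w - y\<^sub>0) - (T u - (y\<^sub>0 + c *\<^sub>R y))"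
        using c by (simp add: x_def T.scaleR T.diff algebra_simps)
      then have "c * norm (y - T x) \<le> norm (T w - y\<^sub>0) + norm (T u - (y\<^sub>0 + c *\<^sub>R y))"
        using c norm_triangle_ineq4 by (metis abs_of_pos norm_scaleR)
      also have "\<dots> \<le> 2 * e"
        using u(3) w(3) by (simp add: dist_norm)
      finally show ?thesis
        using r False by (simp add: e_def c_def field_simps)
    qed
    ultimately show ?thesis
      by blast
  qed
  then have "\<exists>g. \<forall>y. g y \<in> D \<and> norm (g y) \<le> C * norm y \<and> norm (y - T (g y)) \<le> norm y / 2"
    by (intro choice) blast
  then obtain g where g: "\<And>y. g y \<in> D" "\<And>y. norm (g y) \<le> C * norm y"
      "\<And>y. norm (y - T (g y)) \<le> norm y / 2"
    by blast
  have "\<exists>x\<in>D. T x = y \<and> norm x \<le> 2 * C * norm y" for y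
  proof -
    \<comment> \<open>The remainder after \<open>k\<close> approximation steps.\<close>
    define z where "z k = ((\<lambda>z. z - T (g z)) ^^ k) y" for k
    have z_Suc: "z (Suc k) = z k - T (g (z k))" and z_0: "z 0 = y" for k
      by (simp_all add: z_def)
    have z_le: "norm (z k) \<le> norm y * (1 / 2) ^ k" for k
    proof (induction k)
      case (Suc k)
      then show ?case
        using g(3)[of "z k"] by (simp add: z_Suc)
    qed (simp add: z_0)
    have g_le: "norm (g (z k)) \<le> (C * norm y) * (1 / 2) ^ k" for k
      using order_trans[OF g(2) mult_left_mono[OF z_le C]] by (simp add: mult.assoc)
    have geo: "(\<lambda>k. (C * norm y) * (1 / 2) ^ k) sums ((C * norm y) * 2)"
      using geometric_sums[of "1 / 2 :: real"] by (intro sums_mult) simp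
    have summable: "summable (\<lambda>k. g (z k))"
      by (rule summable_comparison_test'[OF sums_summable[OF geo] g_le])
    define x where "x = (\<Sum>k. g (z k))"
    have partial: "T (\<Sum>k<m. g (z k)) = y - z m" for m
      by (induction m) (simp_all add: z_0 z_Suc T.add T.zero)
    have "x \<in> D"
    proof (rule Lim_in_closed_set[OF D(2)])
      show "(\<lambda>m. \<Sum>k<m. g (z k)) \<longlonglongrightarrow> x"
        unfolding x_def by (rule summable_LIMSEQ[OF summable])
    qed (auto intro!: always_eventually subspace_sum[OF D(1)] g(1))
    moreover have "T x = y"
    proof (rule LIMSEQ_unique)
      show "(\<lambda>m. T (\<Sum>k<m. g (z k))) \<longlonglongrightarrow> T x"
        unfolding x_def by (intro T.tendsto summable_LIMSEQ summable)
      have "z \<longlonglongrightarrow> 0"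
      proof (rule Lim_null_comparison)
        show "\<forall>\<^sub>F k in sequentially. norm (z k) \<le> norm y * (1 / 2) ^ k"
          by (intro always_eventually allI z_le)
        show "(\<lambda>k. norm y * (1 / 2) ^ k) \<longlonglongrightarrow> 0"
          by (intro tendsto_mult_right_zero LIMSEQ_power_zero) simp
      qed
      then have "(\<lambda>m. y - z m) \<longlonglongrightarrow> y - 0"
        by (intro tendsto_intros)
      then show "(\<lambda>m. T (\<Sum>k<m. g (z k))) \<longlonglongrightarrow> y"
        by (simp add: partial)
    qed
    moreover have "norm x \<le> 2 * C * norm y"
      using norm_suminf_le[OF g_le sums_summable[OF geo]]
      unfolding x_def sums_unique[OF geo, symmetric] by (simp add: mult_ac)
    ultimately show ?thesis
      by blast
  qed
  then show ?thesis
    using that[of "2 * C"] C by auto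
qed

lemma closed_if_compact_balls:
  fixes W :: "'a::real_normed_vector set"
  assumes "\<And>c. compact (W \<inter> cball 0 c)"
  shows "closed W"
  unfolding closed_sequential_limits
proof safe
  fix x l
  assume x: "\<forall>n. x n \<in> W" and lim: "x \<longlonglongrightarrow> l"
  obtain c where "\<And>n. norm (x n) \<le> c"
    using convergent_imp_bounded[OF lim] by (auto simp: bounded_iff)
  then have "\<forall>n. x n \<in> W \<inter> cball 0 c"
    using x by simp
  then have "l \<in> W \<inter> cball 0 c"
    using closed_sequentially[OF compact_imp_closed[OF assms] _ lim] by blast
  then show "l \<in> W"
    by simp
qed

text \<open>
  In the induction step the coefficient \<open>t\<close> of the new vector \<open>v\<close> is controlled by the distance \<open>d\<close>
  of \<open>v\<close> to the span of the others: \<open>|t| d \<le> norm x\<close>. The ball is thus a closed part of the continuous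
  image of a compact product.
\<close>
lemma compact_span_cball:
  fixes F :: "'a::real_normed_vector set"
  assumes "finite F"
  shows "compact (span F \<inter> cball 0 c)"
  using assms
proof (induction F arbitrary: c rule: finite_induct)
  case empty
  show ?case
    by (cases "0 \<le> c") auto
next
  case (insert v F)
  show ?case
  proof (cases "v \<in> span F")
    case True
    then show ?thesis
      using insert.IH by (simp add: span_redundant)
  next
    case False
    have "closed (span F)"
      by (rule closed_if_compact_balls[OF insert.IH])
    then have d: "0 < infdist v (span F)" (is "0 < ?d")
      using False span_0 by (intro infdist_pos_not_in_closed) auto
    let ?T = "{- (c / ?d)..c / ?d}" and ?S = "span F \<inter> cball 0 (c + c / ?d * norm v)"
    let ?f = "\<lambda>(t::real, s). t *\<^sub>R v + s"
    have "x \<in> ?f ` (?T \<times> ?S)" if x: "x \<in> span (insert v F)" "norm x \<le> c" for x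
    proof -
      obtain t where t: "x - t *\<^sub>R v \<in> span F"
        using x(1) by (auto simp: span_breakdown_eq)
      have t_le: "\<bar>t\<bar> * ?d \<le> norm x"
      proof (cases "t = 0")
        case False
        have "?d \<le> dist v ((- (1 / t)) *\<^sub>R (x - t *\<^sub>R v))"
          by (rule infdist_le[OF span_scale[OF t]])
        also have "\<dots> = norm x / \<bar>t\<bar>"
          using False by (simp add: dist_norm algebra_simps)
        finally show ?thesis
          using False by (simp add: field_simps)
      qed simp
      then have t_c: "\<bar>t\<bar> \<le> c / ?d"
        using x(2) d by (simp add: field_simps)
      have "norm (x - t *\<^sub>R v) \<le> norm x + \<bar>t\<bar> * norm v"
        using norm_triangle_ineq4[of x "t *\<^sub>R v"] by simp
      also have "\<dots> \<le> c + c / ?d * norm v"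
        using x(2) t_c by (intro add_mono mult_right_mono) auto
      finally have "(t, x - t *\<^sub>R v) \<in> ?T \<times> ?S"
        using t t_c by auto
      then show ?thesis
        by (rule rev_image_eqI) simp
    qed
    moreover have "t *\<^sub>R v + s \<in> span (insert v F)" if "s \<in> span F" for t s
      unfolding span_breakdown_eq using that by (intro exI[of _ t]) simp
    then have "?f ` (?T \<times> ?S) \<subseteq> span (insert v F)"
      by auto
    ultimately have "span (insert v F) \<inter> cball 0 c = ?f ` (?T \<times> ?S) \<inter> cball 0 c"
      by auto
    moreover have "compact (?f ` (?T \<times> ?S))"
      by (intro compact_continuous_image compact_Times compact_Icc insert.IH)
        (auto simp: case_prod_unfold intro!: continuous_intros)
    ultimately show ?thesis
      by (simp add: compact_Int_closed)
  qed
qed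

lemma closed_span_finite: "finite F \<Longrightarrow> closed (span F :: 'a::real_normed_vector set)"
  by (rule closed_if_compact_balls[OF compact_span_cball])

text \<open>
  Preimages of a basis of the part of the target space that lies in the range generate, together
  with the kernel, the preimage of the space.
\<close>
lemma preimage_finite_dim:
  fixes A :: "'a::real_vector \<Rightarrow> 'b::real_vector"
  assumes A: "linear A" and ker: "{x. A x = 0} \<subseteq> span F" and fin: "finite F" "finite G"
  obtains H where "finite H" "{x. A x \<in> span G} \<subseteq> span H"
proof -
  obtain B where B: "B \<subseteq> span G \<inter> range A" "independent B" "span G \<inter> range A \<subseteq> span B"
    using basis_exists[of "span G \<inter> range A"] by metis
  have "finite B"
    using independent_span_bound[OF fin(2) B(2)] B(1) by auto
  moreover have "B \<subseteq> range A"
    using B(1) by auto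
  ultimately obtain Z where Z: "finite Z" "B = A ` Z"
    using finite_subset_image by metis
  have "x \<in> span (F \<union> Z)" if "A x \<in> span G" for x
  proof -
    have "A x \<in> A ` span Z"
      using B(3) that by (auto simp: Z(2) linear_span_image[OF A])
    then obtain z where z: "z \<in> span Z" "A x = A z"
      by auto
    then have "x - z \<in> span F"
      using ker by (auto simp: linear_diff[OF A])
    then have "(x - z) + z \<in> span (F \<union> Z)"
      using z(1) by (intro span_add) (use span_mono[of F "F \<union> Z"] span_mono[of Z "F \<union> Z"] in auto)
    then show ?thesis
      by simp
  qed
  then show ?thesis
    using that[of "F \<union> Z"] fin Z by auto
qed

section \<open>Tight sets and limit operators\<close>

lemma tendsto_zero_by_approximation:
  fixes a :: "nat \<Rightarrow> 'a::real_normed_vector"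
  assumes "\<And>e. 0 < e \<Longrightarrow> \<exists>c. c \<longlonglongrightarrow> (0::real) \<and> (\<forall>n. norm (a n) \<le> e + c n)"
  shows "a \<longlonglongrightarrow> 0"
proof (rule tendstoI)
  fix e :: real
  assume "0 < e"
  then obtain c where c: "c \<longlonglongrightarrow> 0" "\<And>n. norm (a n) \<le> e / 2 + c n"
    using assms[of "e / 2"] by auto
  have "\<forall>\<^sub>F n in sequentially. c n < e / 2"
    using c(1) \<open>0 < e\<close> by (intro order_tendstoD) auto
  then show "\<forall>\<^sub>F n in sequentially. dist (a n) 0 < e"
  proof eventually_elim
    case (elim n)
    then show ?case
      using c(2)[of n] by simp
  qed
qed

lemma tendsto_zero_index:
  fixes z :: "nat \<Rightarrow> 'a::real_normed_vector"
  assumes "z \<longlonglongrightarrow> 0" "0 < e"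
  obtains m where "m \<ge> 1" "norm (z m) * c \<le> e"
proof -
  have "(\<lambda>m. norm (z m) * c) \<longlonglongrightarrow> 0"
    using assms(1) by (intro tendsto_mult_left_zero tendsto_norm_zero)
  then have "\<forall>\<^sub>F m in sequentially. norm (z m) * c < e \<and> m \<ge> 1"
    using assms(2) by (intro eventually_conj order_tendstoD eventually_ge_at_top)
  then show ?thesis
    using that by (auto simp: eventually_sequentially intro: less_imp_le)
qed

context limit_operator_setting
begin

abbreviation Q :: "nat \<Rightarrow> 'y \<Rightarrow>\<^sub>L 'y" where
  "Q \<equiv> compl_op P"

lemma P_plus_Q: "P n x + Q n x = x"
  by (simp add: compl_op_def blinfun.diff_left)

lemma norm_P_apply_le: "norm (P n x) \<le> norm x"
  using cSUP_upper[OF UNIV_I P_bdd[of x], of n] P_sup[of x] by simp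

lemma norm_Q_apply_le: "norm (Q n x) \<le> 2 * norm x"
  using norm_triangle_ineq4[of x "P n x"] norm_P_apply_le[of n x]
  by (simp add: compl_op_def blinfun.diff_left)

text \<open>
  This is how \<open>P\<close>-convergence is exploited: composed with a fixed \<open>P m\<close> on either side, it is
  convergence in norm.
\<close>
lemma P_in_K_ops: "P m \<in> K_ops scl P"
proof -
  obtain N where N: "\<And>n. n \<ge> N \<Longrightarrow> P n o\<^sub>L P m = P m \<and> P m o\<^sub>L P n = P m"
    using P_absorb[of m] by blast
  have "P m o\<^sub>L Q n = 0 \<and> Q n o\<^sub>L P m = 0" if "n \<ge> N" for n
  proof -
    have "P m (P n x) = P m x \<and> P n (P m x) = P m x" for x
      using N[OF that] by (metis blinfun_apply_blinfun_compose)
    then show ?thesis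
      by (auto intro!: blinfun_eqI simp: compl_op_def blinfun.diff_left blinfun.diff_right)
  qed
  then have "\<forall>\<^sub>F n in sequentially. norm (P m o\<^sub>L Q n) = 0"
    "\<forall>\<^sub>F n in sequentially. norm (Q n o\<^sub>L P m) = 0"
    by (auto simp: eventually_sequentially)
  then show ?thesis
    using P_op by (auto simp: K_ops_def intro: tendsto_eventually)
qed

lemma V_cancel: "V (- k) (V k x) = x" "V k (V (- k) x) = x"
  using V_add[of "- k" k] V_add[of k "- k"] V_zero
  by (metis blinfun_apply_blinfun_compose blinfun_apply_id_blinfun id_apply add.left_inverse
      add.right_inverse)+

lemma P_V_P_null:
  assumes "m \<ge> 1" "k \<ge> 1" "filterlim (\<lambda>n. znorm (h n)) at_top sequentially"
  shows "(\<lambda>n. norm (P m o\<^sub>L V (h n) o\<^sub>L P k)) \<longlonglongrightarrow> 0"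
proof -
  obtain k\<^sub>0 where "\<And>l. znorm l > k\<^sub>0 \<Longrightarrow> P m o\<^sub>L V l o\<^sub>L P k = 0"
    using P_V_P[OF assms(1,2)] by blast
  moreover have "\<forall>\<^sub>F n in sequentially. znorm (h n) > k\<^sub>0"
    using assms(3) unfolding filterlim_at_top
    by (elim allE[of _ "k\<^sub>0 + 1"]) (auto elim: eventually_mono)
  ultimately show ?thesis
    by (intro tendsto_eventually) (auto elim: eventually_mono)
qed

definition tight :: "'y set \<Rightarrow> bool" where
  "tight S \<longleftrightarrow> (\<forall>e>0. \<exists>m\<ge>1. \<forall>s\<in>S. norm (Q m s) \<le> e)"

text \<open>
  Up to a uniformly small error, elements of \<open>S\<close> lie in the range of a single \<open>P k\<close>, and
  \<open>P m V P k\<close> vanishes for far shifts. Asking for \<open>m \<ge> 1\<close> here and in the definition of tightness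
  matches the range of indices in the condition on \<open>V\<close>.
\<close>
lemma tight_null_shift:
  assumes S: "tight S" "\<And>n. s n \<in> S" "\<And>n. norm (s n) \<le> c"
    and h: "filterlim (\<lambda>n. znorm (h n)) at_top sequentially" and m: "m \<ge> 1"
  shows "(\<lambda>n. P m (V (h n) (s n))) \<longlonglongrightarrow> 0"
proof (rule tendsto_zero_by_approximation)
  fix e :: real
  assume "0 < e"
  then obtain k where k: "k \<ge> 1" "\<And>x. x \<in> S \<Longrightarrow> norm (Q k x) \<le> e"
    using S(1) unfolding tight_def by blast
  have "norm (P m (V (h n) (s n))) \<le> e + norm (P m o\<^sub>L V (h n) o\<^sub>L P k) * c" for n
  proof -
    have "P m (V (h n) (s n)) = P m (V (h n) (P k (s n))) + P m (V (h n) (Q k (s n)))"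
      by (metis P_plus_Q blinfun.add_right)
    then have "norm (P m (V (h n) (s n)))
        \<le> norm ((P m o\<^sub>L V (h n) o\<^sub>L P k) (s n)) + norm (P m (V (h n) (Q k (s n))))"
      by (simp add: norm_triangle_ineq)
    also have "\<dots> \<le> norm (P m o\<^sub>L V (h n) o\<^sub>L P k) * c + e"
    proof (rule add_mono)
      show "norm ((P m o\<^sub>L V (h n) o\<^sub>L P k) (s n)) \<le> norm (P m o\<^sub>L V (h n) o\<^sub>L P k) * c"
        by (rule order_trans[OF norm_blinfun mult_left_mono[OF S(3)]]) simp
      show "norm (P m (V (h n) (Q k (s n)))) \<le> e"
        using norm_P_apply_le[of m "V (h n) (Q k (s n))"] k(2)[OF S(2)] V_isometry
        by (metis order_trans)
    qed
    finally show ?thesis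
      by simp
  qed
  moreover have "(\<lambda>n. norm (P m o\<^sub>L V (h n) o\<^sub>L P k) * c) \<longlonglongrightarrow> 0"
    by (rule tendsto_mult_left_zero[OF P_V_P_null[OF m k(1) h]])
  ultimately show "\<exists>c. c \<longlonglongrightarrow> 0 \<and> (\<forall>n. norm (P m (V (h n) (s n))) \<le> e + c n)"
    by blast
qed

definition invertible_modulo_tight :: "('y \<Rightarrow>\<^sub>L 'y) \<Rightarrow> real \<Rightarrow> bool" where
  "invertible_modulo_tight A C \<longleftrightarrow>
     (\<exists>U. tight U \<and> (\<forall>x. norm x \<le> 1 \<longrightarrow> (\<exists>u\<in>U. norm (x - u) \<le> C * norm (A x)))) \<and>
     (\<exists>S. tight S \<and> (\<forall>y. norm y \<le> 1 \<longrightarrow> (\<exists>x. norm x \<le> C \<and> y - A x \<in> S)))"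

lemma invertible_modulo_tightI:
  fixes A :: "'y \<Rightarrow>\<^sub>L 'y"
  assumes "tight U" "\<And>x. norm x \<le> 1 \<Longrightarrow> \<exists>u\<in>U. norm (x - u) \<le> C * norm (A x)"
    and "tight S" "\<And>y. norm y \<le> 1 \<Longrightarrow> \<exists>x. norm x \<le> C \<and> y - A x \<in> S"
  shows "invertible_modulo_tight A C"
  using assms unfolding invertible_modulo_tight_def by blast

end

locale perfect_limit_operator_setting = limit_operator_setting scl P V
  for scl :: "'k::real_or_complex \<Rightarrow> 'y::banach \<Rightarrow> 'y"
    and P :: "nat \<Rightarrow> 'y \<Rightarrow>\<^sub>L 'y"
    and V :: "int ^ 'n \<Rightarrow> 'y \<Rightarrow>\<^sub>L 'y" +
  assumes perfect: "perfect scl P"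
begin

lemma P_tendsto: "(\<lambda>n. P n x) \<longlonglongrightarrow> x"
  using perfect by (auto simp: perfect_def)

lemma Q_tendsto: "(\<lambda>n. Q n x) \<longlonglongrightarrow> 0"
  using tendsto_diff[OF tendsto_const P_tendsto, of x x]
  by (simp add: compl_op_def blinfun.diff_left)

lemma dual_Q_tendsto:
  assumes "f \<in> dual_space scl"
  shows "(\<lambda>n. f o\<^sub>L Q n) \<longlonglongrightarrow> 0"
proof -
  have "(\<lambda>n. f - adjoint_op (P n) f) \<longlonglongrightarrow> f - f"
    using perfect assms by (intro tendsto_intros) (auto simp: perfect_def)
  moreover have "f - adjoint_op (P n) f = f o\<^sub>L Q n" for n
    by (rule blinfun_eqI)
      (simp add: adjoint_op_def compl_op_def blinfun.diff_left blinfun.diff_right)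
  ultimately show ?thesis
    by simp
qed

text \<open>
  Strong convergence of a uniformly bounded sequence of operators is uniform on compact sets.
\<close>
lemma compact_imp_tight:
  assumes "compact S"
  shows "tight S"
  unfolding tight_def
proof (intro allI impI)
  fix e :: real
  assume e: "0 < e"
  obtain T where T: "finite T" "T \<subseteq> S" "S \<subseteq> (\<Union>t\<in>T. ball t (e / 4))"
    using compactE_image[OF assms, of S "\<lambda>t. ball t (e / 4)"] e
    by (metis UN_I centre_in_ball divide_pos_pos open_ball subsetI zero_less_numeral)
  have "\<forall>\<^sub>F m in sequentially. norm (Q m t) < e / 2" for t
    using tendsto_norm_zero[OF Q_tendsto[of t]] e by (intro order_tendstoD) auto
  then have "\<forall>\<^sub>F m in sequentially. (\<forall>t\<in>T. norm (Q m t) < e / 2) \<and> m \<ge> 1"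
    using T(1) by (intro eventually_conj eventually_ge_at_top) (simp add: eventually_ball_finite)
  then obtain m where m: "m \<ge> 1" "\<And>t. t \<in> T \<Longrightarrow> norm (Q m t) < e / 2"
    by (auto simp: eventually_sequentially)
  have "norm (Q m s) \<le> e" if "s \<in> S" for s
  proof -
    have "s \<in> (\<Union>t\<in>T. ball t (e / 4))"
      using T(3) that by blast
    then obtain t where t: "t \<in> T" "dist t s < e / 4"
      by auto
    have "norm (Q m s) \<le> norm (Q m t) + norm (Q m (s - t))"
      using norm_triangle_ineq[of "Q m t" "Q m (s - t)"] by (simp add: blinfun.diff_right)
    also have "\<dots> \<le> e"
      using m(2)[OF t(1)] norm_Q_apply_le[of m "s - t"] t(2)
      by (simp add: dist_norm norm_minus_commute)
    finally show ?thesis .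
  qed
  then show "\<exists>m\<ge>1. \<forall>s\<in>S. norm (Q m s) \<le> e"
    using m(1) by blast
qed

context
  fixes A B h
  assumes lim: "is_limit_operator scl P V A h B"
begin

abbreviation shifted :: "nat \<Rightarrow> 'y \<Rightarrow>\<^sub>L 'y" where
  "shifted n \<equiv> V (- h n) o\<^sub>L A o\<^sub>L V (h n)"

lemma norm_shifted_diff_le: "norm (shifted n - B) \<le> norm A + norm B"
proof -
  have "norm (shifted n) \<le> norm A"
  proof (rule norm_blinfun_bound)
    show "norm (shifted n x) \<le> norm A * norm x" for x
      using norm_blinfun[of A "V (h n) x"] by (simp add: V_isometry)
  qed simp
  then show ?thesis
    using norm_triangle_ineq4[of "shifted n" B] by simp
qed

lemma h_at_top: "filterlim (\<lambda>n. znorm (h n)) at_top sequentially"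
  using lim by (simp add: is_limit_operator_def)

lemma h_minus_at_top: "filterlim (\<lambda>n. znorm (- h n)) at_top sequentially"
  using h_at_top by (simp add: znorm_def)

lemma shifted_tendsto: "(\<lambda>n. shifted n x) \<longlonglongrightarrow> B x"
proof -
  have "(\<lambda>n. (shifted n - B) x) \<longlonglongrightarrow> 0"
  proof (rule tendsto_zero_by_approximation)
    fix e :: real
    assume "0 < e"
    then obtain m where m: "norm (Q m x) * (norm A + norm B) \<le> e"
      using tendsto_zero_index[OF Q_tendsto] by blast
    have "norm ((shifted n - B) x) \<le> e + norm ((shifted n - B) o\<^sub>L P m) * norm x" for n
    proof -
      have "(shifted n - B) x = (shifted n - B) (P m x) + (shifted n - B) (Q m x)"
        by (metis P_plus_Q blinfun.add_right)
      then have "norm ((shifted n - B) x)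
          \<le> norm (((shifted n - B) o\<^sub>L P m) x) + norm ((shifted n - B) (Q m x))"
        by (simp add: norm_triangle_ineq)
      also have "\<dots> \<le> norm ((shifted n - B) o\<^sub>L P m) * norm x
          + (norm A + norm B) * norm (Q m x)"
        by (intro add_mono norm_blinfun
            order_trans[OF norm_blinfun mult_right_mono[OF norm_shifted_diff_le]]) simp
      finally show ?thesis
        using m by (simp add: mult.commute)
    qed
    moreover have "(\<lambda>n. norm ((shifted n - B) o\<^sub>L P m) * norm x) \<longlonglongrightarrow> 0"
      using lim P_in_K_ops[of m]
      by (intro tendsto_mult_left_zero) (simp add: is_limit_operator_def P_convergent_def)
    ultimately show "\<exists>c. c \<longlonglongrightarrow> 0 \<and> (\<forall>n. norm ((shifted n - B) x) \<le> e + c n)"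
      by blast
  qed
  then show ?thesis
    by (subst LIM_zero_iff[symmetric]) (simp add: blinfun.diff_left)
qed

lemma dual_shifted_tendsto:
  assumes f: "f \<in> dual_space scl"
  shows "(\<lambda>n. f o\<^sub>L (shifted n - B)) \<longlonglongrightarrow> 0"
proof (rule tendsto_zero_by_approximation)
  fix e :: real
  assume "0 < e"
  then obtain m where m: "norm (f o\<^sub>L Q m) * (norm A + norm B) \<le> e"
    using tendsto_zero_index[OF dual_Q_tendsto[OF f]] by blast
  have "norm (f o\<^sub>L (shifted n - B)) \<le> e + norm f * norm (P m o\<^sub>L (shifted n - B))" for n
  proof -
    let ?D = "shifted n - B"
    have "f o\<^sub>L ?D = ((f o\<^sub>L Q m) o\<^sub>L ?D) + (f o\<^sub>L (P m o\<^sub>L ?D))"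
    proof (rule blinfun_eqI)
      fix x
      have "f (?D x) = f (P m (?D x)) + f (Q m (?D x))"
        by (metis P_plus_Q blinfun.add_right)
      then show "(f o\<^sub>L ?D) x = (((f o\<^sub>L Q m) o\<^sub>L ?D) + (f o\<^sub>L (P m o\<^sub>L ?D))) x"
        by (simp add: blinfun.add_left)
    qed
    then have "norm (f o\<^sub>L ?D) \<le> norm ((f o\<^sub>L Q m) o\<^sub>L ?D) + norm (f o\<^sub>L (P m o\<^sub>L ?D))"
      by (simp add: norm_triangle_ineq)
    also have "\<dots> \<le> norm (f o\<^sub>L Q m) * (norm A + norm B) + norm f * norm (P m o\<^sub>L ?D)"
      by (intro add_mono norm_blinfun_compose
          order_trans[OF norm_blinfun_compose mult_left_mono[OF norm_shifted_diff_le]]) simp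
    finally show ?thesis
      using m by simp
  qed
  moreover have "(\<lambda>n. norm f * norm (P m o\<^sub>L (shifted n - B))) \<longlonglongrightarrow> 0"
    using lim P_in_K_ops[of m]
    by (intro tendsto_mult_right_zero) (simp add: is_limit_operator_def P_convergent_def)
  ultimately show "\<exists>c. c \<longlonglongrightarrow> 0 \<and> (\<forall>n. norm (f o\<^sub>L (shifted n - B)) \<le> e + c n)"
    by blast
qed

text \<open>
  Apply the lower estimate to \<open>V (h n) x\<close>, which has the norm of \<open>x\<close>. The element \<open>u\<close> of the tight set
  is nearly \<open>P m u\<close>, and \<open>P m (V (h n) x) \<rightarrow> 0\<close>, so the norm of \<open>u\<close> is in the limit bounded by that of
  \<open>V (h n) x - u\<close>. Thus the estimate is used twice, hence the factor 2.
\<close>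
lemma limit_operator_bounded_below:
  assumes U: "tight U"
    and lower: "\<And>x. norm x \<le> 1 \<Longrightarrow> \<exists>u\<in>U. norm (x - u) \<le> C * norm (A x)"
  shows "norm x \<le> 2 * C * norm (B x)"
proof -
  have unit: "norm x \<le> 2 * C * norm (B x)" if x: "norm x \<le> 1" for x
  proof (rule field_le_epsilon)
    fix e :: real
    assume "0 < e"
    then obtain m where m: "m \<ge> 1" "\<And>u. u \<in> U \<Longrightarrow> norm (Q m u) \<le> e"
      using U unfolding tight_def by blast
    have le: "norm x \<le> 2 * C * norm (shifted n x) + e + norm (P m (V (h n) x))" for n
    proof -
      obtain u where u: "u \<in> U" "norm (V (h n) x - u) \<le> C * norm (A (V (h n) x))"
        using lower[of "V (h n) x"] x by (auto simp: V_isometry)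
      have "norm x \<le> norm (V (h n) x - u) + norm u"
        using norm_triangle_ineq[of "V (h n) x - u" u] by (simp add: V_isometry)
      moreover have "norm u \<le> norm (Q m u) + norm (P m u)"
        by (metis P_plus_Q add.commute norm_triangle_ineq)
      moreover have "norm (P m u) \<le> norm (P m (V (h n) x)) + norm (V (h n) x - u)"
        using norm_triangle_ineq4[of "P m (V (h n) x)" "P m (V (h n) x - u)"]
          norm_P_apply_le[of m "V (h n) x - u"]
        by (simp add: blinfun.diff_right)
      ultimately show ?thesis
        using u(2) m(2)[OF u(1)] by (simp add: V_isometry)
    qed
    have "tight {x}"
      by (rule compact_imp_tight) simp
    then have "(\<lambda>n. P m (V (h n) x)) \<longlonglongrightarrow> 0"
      by (rule tight_null_shift[where c = "norm x"]) (use h_at_top m(1) in auto)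
    then have "(\<lambda>n. 2 * C * norm (shifted n x) + e + norm (P m (V (h n) x)))
        \<longlonglongrightarrow> 2 * C * norm (B x) + e + 0"
      by (intro tendsto_intros shifted_tendsto tendsto_norm_zero)
    then show "norm x \<le> 2 * C * norm (B x) + e"
      using le LIMSEQ_le_const by force
  qed
  show ?thesis
  proof (cases "x = 0")
    case False
    then have "norm ((1 / norm x) *\<^sub>R x) \<le> 2 * C * norm (B ((1 / norm x) *\<^sub>R x))"
      by (intro unit) simp
    then show ?thesis
      using False by (simp add: blinfun.scaleR_right field_simps)
  qed simp
qed

text \<open>
  Solve \<open>V (h n) y = A x + s\<close> with bounded \<open>x\<close> and tight \<open>s\<close>, and apply \<open>f \<circ> V (- h n)\<close>. The first
  term tends to 0 because the shifted operators composed with \<open>f\<close> converge in norm to \<open>f \<circ> B = 0\<close>,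
  the second because \<open>f\<close> is nearly \<open>f \<circ> P m\<close> and \<open>s\<close> is shifted to infinity. The left-hand side is
  \<open>f y\<close> for all \<open>n\<close>.
\<close>
lemma limit_operator_annihilator:
  assumes S: "tight S"
    and upper: "\<And>y. norm y \<le> 1 \<Longrightarrow> \<exists>x. norm x \<le> C \<and> y - A x \<in> S"
    and f: "f \<in> dual_space scl" "f o\<^sub>L B = 0"
  shows "f y = 0"
proof -
  have unit: "f y = 0" if y: "norm y \<le> 1" for y
  proof -
    have "\<forall>n. \<exists>x. norm x \<le> C \<and> V (h n) y - A x \<in> S"
      using upper y by (simp add: V_isometry)
    then obtain x where x: "\<And>n. norm (x n) \<le> C" "\<And>n. V (h n) y - A (x n) \<in> S"
      by metis
    define s where "s n = V (h n) y - A (x n)" for n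
    define c where "c = 1 + norm A * C"
    have s_le: "norm (s n) \<le> c" for n
    proof -
      have "norm (A (x n)) \<le> norm A * C"
        by (rule order_trans[OF norm_blinfun mult_left_mono[OF x(1)]]) simp
      then show ?thesis
        using norm_triangle_ineq4[of "V (h n) y" "A (x n)"] y
        by (simp add: s_def c_def V_isometry)
    qed
    have split: "f y = (f o\<^sub>L (shifted n - B)) (V (- h n) (x n)) + f (V (- h n) (s n))" for n
    proof -
      have "f (B z) = 0" for z
        using f(2) by (metis blinfun_apply_blinfun_compose zero_blinfun.rep_eq)
      then show ?thesis
        by (simp add: s_def V_cancel blinfun.diff_left blinfun.diff_right)
    qed
    have "(\<lambda>n. (f o\<^sub>L (shifted n - B)) (V (- h n) (x n))) \<longlonglongrightarrow> 0"
    proof (rule Lim_null_comparison)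
      show "(\<lambda>n. norm (f o\<^sub>L (shifted n - B)) * C) \<longlonglongrightarrow> 0"
        by (intro tendsto_mult_left_zero tendsto_norm_zero dual_shifted_tendsto[OF f(1)])
      show "\<forall>\<^sub>F n in sequentially. norm ((f o\<^sub>L (shifted n - B)) (V (- h n) (x n)))
          \<le> norm (f o\<^sub>L (shifted n - B)) * C"
        by (intro always_eventually allI order_trans[OF norm_blinfun mult_left_mono])
          (simp_all add: V_isometry x(1))
    qed
    moreover have "(\<lambda>n. f (V (- h n) (s n))) \<longlonglongrightarrow> 0"
    proof (rule tendsto_zero_by_approximation)
      fix e :: real
      assume "0 < e"
      then obtain m where m: "m \<ge> 1" "norm (f o\<^sub>L Q m) * c \<le> e"
        using tendsto_zero_index[OF dual_Q_tendsto[OF f(1)]] by blast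
      have "norm (f (V (- h n) (s n))) \<le> e + norm (f (P m (V (- h n) (s n))))" for n
      proof -
        let ?z = "V (- h n) (s n)"
        have "f ?z = (f o\<^sub>L Q m) ?z + f (P m ?z)"
          by (metis P_plus_Q add.commute blinfun.add_right blinfun_apply_blinfun_compose)
        moreover have "norm ((f o\<^sub>L Q m) ?z) \<le> norm (f o\<^sub>L Q m) * c"
          by (rule order_trans[OF norm_blinfun mult_left_mono]) (simp_all add: V_isometry s_le)
        ultimately show ?thesis
          using m(2) norm_triangle_ineq[of "(f o\<^sub>L Q m) ?z" "f (P m ?z)"] by simp
      qed
      moreover have "(\<lambda>n. norm (f (P m (V (- h n) (s n))))) \<longlonglongrightarrow> 0"
      proof (intro tendsto_norm_zero)
        have "(\<lambda>n. P m (V (- h n) (s n))) \<longlonglongrightarrow> 0"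
          by (rule tight_null_shift[OF S x(2)[folded s_def] s_le h_minus_at_top m(1)])
        then have "(\<lambda>n. f (P m (V (- h n) (s n)))) \<longlonglongrightarrow> f 0"
          by (intro tendsto_intros)
        then show "(\<lambda>n. f (P m (V (- h n) (s n)))) \<longlonglongrightarrow> 0"
          by (simp add: blinfun.zero_right)
      qed
      ultimately show "\<exists>c. c \<longlonglongrightarrow> 0 \<and> (\<forall>n. norm (f (V (- h n) (s n))) \<le> e + c n)"
        by blast
    qed
    ultimately have "(\<lambda>n. (f o\<^sub>L (shifted n - B)) (V (- h n) (x n)) + f (V (- h n) (s n)))
        \<longlonglongrightarrow> 0 + 0"
      by (rule tendsto_add)
    then show ?thesis
      unfolding split[symmetric] by (simp add: LIMSEQ_const_iff)
  qed
  show ?thesis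
  proof (cases "y = 0")
    case False
    then have "f ((1 / norm y) *\<^sub>R y) = 0"
      by (intro unit) simp
    then show ?thesis
      using False by (simp add: blinfun.scaleR_right)
  qed (simp add: blinfun.zero_right)
qed

end

text \<open>
  The lower bound makes the range closed, and by separation a proper closed range would have a
  nonzero annihilator.
\<close>
lemma limit_operator_invertible:
  fixes A B :: "'y \<Rightarrow>\<^sub>L 'y" and C :: real and y :: 'y
  assumes lim: "is_limit_operator scl P V A h B" and inv: "invertible_modulo_tight A C"
  shows "invertible_op B" "norm (inv (blinfun_apply B) y) \<le> 2 * C * norm y"
proof -
  obtain U S where U: "tight U" "\<And>x. norm x \<le> 1 \<Longrightarrow> \<exists>u\<in>U. norm (x - u) \<le> C * norm (A x)"
    and S: "tight S" "\<And>y. norm y \<le> 1 \<Longrightarrow> \<exists>x. norm x \<le> C \<and> y - A x \<in> S"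
    using inv unfolding invertible_modulo_tight_def by blast
  have lower: "norm x \<le> 2 * C * norm (B x)" for x
    by (rule limit_operator_bounded_below[OF lim U])
  have B: "B (scl c x) = scl c (B x)" for c x
    using lim by (auto simp: is_limit_operator_def bounded_ops_def)
  have "inj B"
  proof (rule injI)
    fix x y
    assume "B x = B y"
    then show "x = y"
      using lower[of "x - y"] by (simp add: blinfun.diff_right)
  qed
  moreover have "range B = UNIV"
  proof (rule ccontr)
    assume "range B \<noteq> UNIV"
    then obtain y where y: "y \<notin> range B"
      by blast
    have "subspace (range B)"
      unfolding subspace_def
    proof (intro conjI ballI allI)
      show "0 \<in> range B"
        by (metis blinfun.zero_right rangeI)
      show "x + z \<in> range B" if "x \<in> range B" "z \<in> range B" for x z
        using that by (auto simp flip: blinfun.add_right)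
      show "scl c x \<in> range B" if "x \<in> range B" for c x
        using that by (auto simp flip: B)
    qed
    moreover have "closed (range B)"
    proof (rule complete_imp_closed, rule complete_isometric_image)
      let ?K = "\<bar>2 * C\<bar> + 1"
      show "0 < 1 / ?K"
        by (simp add: add_nonneg_pos)
      have "norm x \<le> ?K * norm (B x)" for x
        by (rule order_trans[OF lower mult_right_mono]) auto
      then show "\<forall>x\<in>UNIV. 1 / ?K * norm x \<le> norm (B x)"
        by (simp add: field_simps add_nonneg_pos)
    qed (auto simp: complete_UNIV blinfun.bounded_linear_right)
    ultimately obtain f where f: "f \<in> dual_space scl" "\<And>x. x \<in> range B \<Longrightarrow> f x = 0" "f y \<noteq> 0"
      using dual_space_separation y by blast
    have "f o\<^sub>L B = 0"
      by (rule blinfun_eqI) (simp add: f(2))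
    then show False
      using limit_operator_annihilator[OF lim S f(1)] f(3) by blast
  qed
  ultimately show "invertible_op B"
    by (simp add: invertible_op_def bij_def)
  show "norm (inv (blinfun_apply B) y) \<le> 2 * C * norm y"
    using lower[of "inv (blinfun_apply B) y"] \<open>range B = UNIV\<close> by (simp add: surj_f_inv_f)
qed

text \<open>
  From \<open>B A = I + T\<^sub>2\<close> and \<open>A B = I + T\<^sub>1\<close> the tight errors are \<open>- T\<^sub>2 x\<close> and \<open>- T\<^sub>1 y\<close>.
\<close>
lemma invertible_at_infinity_modulo_tight:
  assumes "invertible_at_infinity scl P A"
  obtains C where "invertible_modulo_tight A C"
proof -
  obtain B T\<^sub>1 T\<^sub>2 where T: "T\<^sub>1 \<in> K_ops scl P" "T\<^sub>2 \<in> K_ops scl P"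
    and AB: "A o\<^sub>L B = id_blinfun + T\<^sub>1" and BA: "B o\<^sub>L A = id_blinfun + T\<^sub>2"
    using assms by (auto simp: invertible_at_infinity_def)
  have AB': "A (B y) = y + T\<^sub>1 y" and BA': "B (A x) = x + T\<^sub>2 x" for x y
    using AB BA
    by (metis blinfun_apply_blinfun_compose blinfun.add_left blinfun_apply_id_blinfun id_apply)+
  have tight: "tight ((\<lambda>x. - T x) ` cball 0 1)" if "T \<in> K_ops scl P" for T
    unfolding tight_def
  proof (intro allI impI)
    fix e :: real
    assume e: "0 < e"
    have "(\<lambda>n. Q n o\<^sub>L T) \<longlonglongrightarrow> 0"
      using that by (auto simp: K_ops_def intro: tendsto_norm_zero_cancel)
    then obtain m where m: "m \<ge> 1" "norm (Q m o\<^sub>L T) * 1 \<le> e"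
      using tendsto_zero_index e by blast
    have "norm (Q m (- T x)) \<le> e" if "norm x \<le> 1" for x
    proof -
      have "norm ((Q m o\<^sub>L T) x) \<le> norm (Q m o\<^sub>L T) * 1"
        by (rule order_trans[OF norm_blinfun mult_left_mono[OF that]]) simp
      then show ?thesis
        using m(2) by (simp add: blinfun.minus_right)
    qed
    then show "\<exists>m\<ge>1. \<forall>s\<in>(\<lambda>x. - T x) ` cball 0 1. norm (Q m s) \<le> e"
      using m(1) by auto
  qed
  have "invertible_modulo_tight A (norm B)"
  proof (rule invertible_modulo_tightI[OF tight[OF T(2)] _ tight[OF T(1)]])
    fix x :: 'y
    assume "norm x \<le> 1"
    then show "\<exists>u\<in>(\<lambda>x. - T\<^sub>2 x) ` cball 0 1. norm (x - u) \<le> norm B * norm (A x)"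
      using norm_blinfun[of B "A x"] by (intro bexI[of _ "- T\<^sub>2 x"]) (auto simp: BA')
  next
    fix y :: 'y
    assume y: "norm y \<le> 1"
    then show "\<exists>x. norm x \<le> norm B \<and> y - A x \<in> (\<lambda>x. - T\<^sub>1 x) ` cball 0 1"
      using order_trans[OF norm_blinfun mult_left_mono[OF y], of B]
      by (intro exI[of _ "B y"]) (auto simp: AB')
  qed
  then show ?thesis
    by (rule that)
qed

text \<open>
  Let the range of \<open>A\<close> and a finite-dimensional space \<open>W\<close> span everything. By the open mapping
  theorem \<open>y = A x + s\<close> can be solved with \<open>s\<close> in \<open>W\<close> and both terms controlled. This is the second
  half of the claim; for \<open>y = A x\<close> with solution \<open>x'\<close> it shows that \<open>x\<close> differs from the controlled
  \<open>x'\<close> by an element of the preimage of \<open>W\<close> under \<open>A\<close>. That preimage is finite-dimensional because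
  the kernel is.
\<close>
lemma fredholm_modulo_tight:
  assumes "fredholm scl A"
  obtains C where "invertible_modulo_tight A C"
proof -
  obtain F where F: "finite F" "span F = {x. A x = 0}"
    using assms by (auto simp: fredholm_def finite_dim_def)
  obtain E where E: "finite E" "coset_of (range A) ` span E = range (coset_of (range A))"
    using assms by (auto simp: fredholm_def finite_dim_quotient_def)
  obtain F' where F': "finite F'" "span F \<subseteq> Real_Vector_Spaces.span F'"
    using span_subset_real_span[OF F(1)] by blast
  obtain E' where E': "finite E'" "span E \<subseteq> Real_Vector_Spaces.span E'"
    using span_subset_real_span[OF E(1)] by blast
  have linA: "linear A"
    by (rule bounded_linear.linear) (rule blinfun.bounded_linear_right)
  obtain H where H: "finite H"
      "{x. A x \<in> Real_Vector_Spaces.span E'} \<subseteq> Real_Vector_Spaces.span H"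
    using preimage_finite_dim[OF linA _ F'(1) E'(1)] F(2) F'(2) by metis
  let ?T = "\<lambda>(x, s). A x + s" and ?D = "UNIV \<times> Real_Vector_Spaces.span E'"
  have "bounded_linear (\<lambda>z. A (fst z) + snd z)"
    by (intro bounded_linear_add bounded_linear_snd
        bounded_linear_compose[OF blinfun.bounded_linear_right bounded_linear_fst])
  then have T: "bounded_linear ?T"
    by (simp add: case_prod_unfold)
  have "Real_Vector_Spaces.subspace ?D"
    by (intro subspace_Times) (auto simp: real_vector.subspace_span)
  moreover have "closed ?D"
    by (intro closed_Times closed_UNIV closed_span_finite E')
  moreover have "?T ` ?D = UNIV"
  proof -
    have "y \<in> ?T ` ?D" for y
    proof -
      obtain s where s: "s \<in> span E" "coset_of (range A) y = coset_of (range A) s"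
        using E(2) by (metis imageE rangeI)
      have "y \<in> coset_of (range A) y"
        by (auto simp: coset_of_def image_iff intro!: exI[of _ 0] simp: blinfun.zero_right)
      then obtain x where "y = s + A x"
        unfolding s(2) by (auto simp: coset_of_def)
      then show ?thesis
        using s(1) E'(2) by (intro image_eqI[of _ _ "(x, s)"]) (auto simp: add.commute)
    qed
    then show ?thesis
      by blast
  qed
  ultimately obtain C where C: "0 \<le> C"
      "\<And>y. \<exists>z\<in>?D. ?T z = y \<and> norm z \<le> C * norm y"
    using bounded_preimage_of_surjective[OF T] by blast
  have solve: "\<exists>x s. s \<in> Real_Vector_Spaces.span E' \<and> A x + s = y
      \<and> norm x \<le> C * norm y \<and> norm s \<le> C * norm y" for y
  proof -
    obtain x s where "s \<in> Real_Vector_Spaces.span E'" "A x + s = y" "norm (x, s) \<le> C * norm y"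
      using C(2)[of y] by auto
    then show ?thesis
      using norm_fst_le[of x s] norm_snd_le[of s x]
      by (intro exI[of _ x] exI[of _ s]) auto
  qed
  have "invertible_modulo_tight A C"
  proof (rule invertible_modulo_tightI)
    show "tight (Real_Vector_Spaces.span H \<inter> cball 0 (1 + C * norm A))"
      "tight (Real_Vector_Spaces.span E' \<inter> cball 0 C)"
      by (intro compact_imp_tight compact_span_cball H E')+
  next
    fix x :: 'y
    assume x: "norm x \<le> 1"
    obtain x' s where s: "s \<in> Real_Vector_Spaces.span E'" "A x' + s = A x"
        "norm x' \<le> C * norm (A x)"
      using solve by blast
    have "A (x - x') = s"
      using s(2) by (simp add: blinfun.diff_right algebra_simps)
    then have "x - x' \<in> Real_Vector_Spaces.span H"
      using H(2) s(1) by auto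
    moreover have "norm (x - x') \<le> 1 + C * norm A"
    proof -
      have "norm (A x) \<le> norm A * 1"
        by (rule order_trans[OF norm_blinfun mult_left_mono[OF x]]) simp
      then have "norm x' \<le> C * norm A"
        using s(3) C(1) by (metis mult.right_neutral mult_left_mono order_trans)
      then show ?thesis
        using norm_triangle_ineq4[of x x'] x by simp
    qed
    ultimately show "\<exists>u\<in>Real_Vector_Spaces.span H \<inter> cball 0 (1 + C * norm A).
        norm (x - u) \<le> C * norm (A x)"
      using s(3) by (intro bexI[of _ "x - x'"]) auto
  next
    fix y :: 'y
    assume y: "norm y \<le> 1"
    obtain x s where s: "s \<in> Real_Vector_Spaces.span E'" "A x + s = y"
        "norm x \<le> C * norm y" "norm s \<le> C * norm y"
      using solve by blast
    have "C * norm y \<le> C"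
      using y C(1) by (simp add: mult_left_le)
    moreover have "y - A x = s"
      using s(2) by auto
    ultimately show "\<exists>x. norm x \<le> C \<and> y - A x \<in> Real_Vector_Spaces.span E' \<inter> cball 0 C"
      using s by (intro exI[of _ x]) auto
  qed
  then show ?thesis
    by (rule that)
qed

end

section \<open>Consequences of invertibility and the equivalences\<close>

context limit_operator_setting
begin

lemma invertible_imp_fredholm:
  assumes "invertible_op A"
  shows "fredholm scl A"
proof -
  have inj: "inj A" and surj: "surj A"
    using assms by (auto simp: invertible_op_def bij_def)
  have "{x. A x = 0} = {0}"
    using injD[OF inj, of _ 0] by (auto simp: blinfun.zero_right)
  then have "finite_dim scl {x. A x = 0}"
    unfolding finite_dim_def by (intro exI[of _ "{}"]) simp
  moreover have "finite_dim_quotient scl (range A)"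
  proof -
    have coset: "coset_of UNIV y = UNIV" for y :: 'y
      unfolding coset_of_def by (rule surj_plus)
    have "coset_of UNIV ` span {} = range (coset_of (UNIV :: 'y set))"
      unfolding coset by (simp add: image_constant_conv)
    then show ?thesis
      unfolding finite_dim_quotient_def surj by (intro exI[of _ "{}"] conjI) simp_all
  qed
  ultimately show ?thesis
    by (simp add: fredholm_def)
qed

lemma invertible_imp_invertible_at_infinity:
  assumes A: "A \<in> bounded_ops scl" and "invertible_op A"
  shows "invertible_at_infinity scl P A"
proof -
  have inj: "inj A" and surj: "surj A"
    using assms by (auto simp: invertible_op_def bij_def)
  obtain C where C: "0 \<le> C" "\<And>y. \<exists>x\<in>UNIV. A x = y \<and> norm x \<le> C * norm y"
    using bounded_preimage_of_surjective
      [OF blinfun.bounded_linear_right real_vector.subspace_UNIV closed_UNIV surj] by metis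
  have inv: "A (inv A y) = y" "inv A (A x) = x" for x y
    using inj surj by (simp_all add: surj_f_inv_f)
  have eqI: "inv A y = x" if "A x = y" for x y
    using that inv(2) by blast
  have "bounded_linear (inv A)"
  proof (rule bounded_linear_intro[where K = C])
    show "norm (inv A y) \<le> norm y * C" for y
      using C(2)[of y] inv(2) by (auto simp: mult.commute)
  qed (auto intro!: eqI simp: blinfun.add_right blinfun.scaleR_right inv)
  then have inv_apply: "blinfun_apply (Blinfun (inv A)) = inv A"
    by (rule bounded_linear_Blinfun_apply)
  have "Blinfun (inv A) \<in> bounded_ops scl"
    using A by (auto simp: bounded_ops_def inv_apply inv intro!: eqI)
  moreover have "A o\<^sub>L Blinfun (inv A) = id_blinfun + 0" "Blinfun (inv A) o\<^sub>L A = id_blinfun + 0"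
    by (auto intro!: blinfun_eqI simp: inv_apply inv)
  moreover have "0 \<in> K_ops scl P"
    by (simp add: K_ops_def bounded_ops_def)
  ultimately show ?thesis
    unfolding invertible_at_infinity_def by blast
qed

end

theorem corollary5p14:
  fixes scl :: "'k::real_or_complex \<Rightarrow> 'y::banach \<Rightarrow> 'y"
    and P :: "nat \<Rightarrow> 'y \<Rightarrow>\<^sub>L 'y"
    and V :: "int ^ 'n \<Rightarrow> 'y \<Rightarrow>\<^sub>L 'y"
    and A :: "'y \<Rightarrow>\<^sub>L 'y"
  assumes "limit_operator_setting scl P V"
    and "perfect scl P"
    and "A \<in> bounded_ops scl"
    and "self_similar scl P V A"
  shows "(invertible_op A \<longleftrightarrow> fredholm scl A) \<and>
    (invertible_op A \<longleftrightarrow> invertible_at_infinity scl P A) \<and>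
    (invertible_op A \<longleftrightarrow>
      (\<forall>B\<in>op_spectrum scl P V A. invertible_op B) \<and>
      inverses_uniformly_bounded (op_spectrum scl P V A)) \<and>
    (invertible_op A \<longleftrightarrow> (\<forall>B\<in>op_spectrum scl P V A. invertible_op B))"
proof -
  interpret limit_operator_setting scl P V
    by (rule assms(1))
  interpret perfect_limit_operator_setting scl P V
    by unfold_locales (rule assms(2))
  let ?a = "invertible_op A" and ?b = "fredholm scl A" and ?c = "invertible_at_infinity scl P A"
  let ?e = "\<forall>B\<in>op_spectrum scl P V A. invertible_op B"
  let ?d = "?e \<and> inverses_uniformly_bounded (op_spectrum scl P V A)"
  have "?d" if "invertible_modulo_tight A C" for C
    using limit_operator_invertible[OF _ that]
    unfolding op_spectrum_def inverses_uniformly_bounded_def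
    by (auto intro!: exI[of _ "2 * C"])
  then have "?b \<Longrightarrow> ?d" "?c \<Longrightarrow> ?d"
    using fredholm_modulo_tight invertible_at_infinity_modulo_tight by metis+
  moreover have "?a \<Longrightarrow> ?b" "?a \<Longrightarrow> ?c"
    using invertible_imp_fredholm invertible_imp_invertible_at_infinity assms(3) by blast+
  moreover have "?e \<Longrightarrow> ?a"
    using assms(4) by (auto simp: self_similar_def)
  ultimately show ?thesis
    by blast
qed

end
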